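(* For all integers $r,s\ge 1$, $\chi_{la}(rDF(2s))=3$.
   Context: For a graph $G=(V,E)$ with $|E|=m$ and no isolated vertices, a local antimagic labeling is a bijection $f:E\to\{1,\dots,m\}$ such that $f^+(u)\ne f^+(v)$ for every edge $uv$, where $f^+(x)=\sum f(e)$ over all edges $e$ incident to $x$. The local antimagic chromatic number $\chi_{la}(G)$ is the minimum, over all local antimagic labelings $f$ of $G$, of the number of distinct values taken by $f^+$ (also for disconnected graphs). $rG$ is the disjoint union of $r$ copies of $G$. For $s\ge 1$, let $S_1,S_2$ be two disjoint copies of $sP_3$ (the disjoint union of $s$ paths on 3 vertices). The diamond fan $DF(2s)$ is obtained from $S_1+S_2$ by adding a vertex $y$ adjacent to every degree-1 vertex of $S_1$ and every degree-2 vertex of $S_2$, and a vertex $z$ adjacent to every degree-1 vertex of $S_2$ and every degree-2 vertex of $S_1$. *)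

theory Defs
  imports "HOL-Library.Extended_Nat"
begin

text \<open>
  Undirected simple graphs are given by a vertex set and a set of two-element sets of vertices.
\<close>

record 'a graph =
  verts :: "'a set"
  edges :: "'a set set"

definition finite_simple_graph :: "'a graph \<Rightarrow> bool" where
  "finite_simple_graph G \<longleftrightarrow>
     finite (verts G) \<and> (\<forall>e\<in>edges G. e \<subseteq> verts G \<and> card e = 2)"

definition degree :: "'a graph \<Rightarrow> 'a \<Rightarrow> nat" where
  "degree G x = card {e \<in> edges G. x \<in> e}"

definition no_isolated_verts :: "'a graph \<Rightarrow> bool" where
  "no_isolated_verts G \<longleftrightarrow> (\<forall>x\<in>verts G. degree G x \<noteq> 0)"

definition vertex_sum :: "'a graph \<Rightarrow> ('a set \<Rightarrow> nat) \<Rightarrow> 'a \<Rightarrow> nat" where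
  "vertex_sum G f x = (\<Sum>e | e \<in> edges G \<and> x \<in> e. f e)"

definition local_antimagic :: "'a graph \<Rightarrow> ('a set \<Rightarrow> nat) \<Rightarrow> bool" where
  "local_antimagic G f \<longleftrightarrow>
     bij_betw f (edges G) {1..card (edges G)} \<and>
     (\<forall>u v. {u, v} \<in> edges G \<longrightarrow> vertex_sum G f u \<noteq> vertex_sum G f v)"

text \<open>
  Intended for finite simple graphs without isolated vertices. The infimum is taken in
  \<^typ>\<open>enat\<close>, so it is the minimum whenever a local antimagic labeling exists,
  and \<open>\<infinity>\<close> otherwise.
\<close>

definition chi_la :: "'a graph \<Rightarrow> enat" where
  "chi_la G = Inf {enat (card (vertex_sum G f ` verts G)) | f. local_antimagic G f}"

text \<open>The disjoint union of \<open>r\<close> copies of \<open>G\<close>; the first component is the index of the copy.\<close>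

definition copies :: "nat \<Rightarrow> 'a graph \<Rightarrow> (nat \<times> 'a) graph" where
  "copies r G =
     \<lparr> verts = {..<r} \<times> verts G,
       edges = {Pair i ` e | i e. i < r \<and> e \<in> edges G} \<rparr>"

definition disjoint_sum :: "'a graph \<Rightarrow> 'b graph \<Rightarrow> ('a + 'b) graph" where
  "disjoint_sum G H =
     \<lparr> verts = verts G <+> verts H,
       edges = (`) Inl ` edges G \<union> (`) Inr ` edges H \<rparr>"

definition path_graph :: "nat \<Rightarrow> nat graph" where
  "path_graph n = \<lparr> verts = {..<n}, edges = {{i, Suc i} | i. Suc i < n} \<rparr>"

datatype 'a with_apexes = Base 'a | ApexY | ApexZ

text \<open>
  The diamond fan \<open>DF(2s)\<close>; note that the argument is \<open>s\<close>. The sum \<open>S\<^sub>1 + S\<^sub>2\<close> in its description is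
  the disjoint union, not the join. Degrees are those in \<open>S\<^sub>1\<close> and \<open>S\<^sub>2\<close> before the apexes are added.
\<close>

definition diamond_fan :: "nat \<Rightarrow> ((nat \<times> nat) + (nat \<times> nat)) with_apexes graph" where
  "diamond_fan s =
     (let S1 = copies s (path_graph 3); S2 = copies s (path_graph 3) in
      \<lparr> verts = Base ` verts (disjoint_sum S1 S2) \<union> {ApexY, ApexZ},
        edges = (`) Base ` edges (disjoint_sum S1 S2)
          \<union> {{ApexY, Base (Inl x)} | x. x \<in> verts S1 \<and> degree S1 x = 1}
          \<union> {{ApexY, Base (Inr x)} | x. x \<in> verts S2 \<and> degree S2 x = 2}
          \<union> {{ApexZ, Base (Inr x)} | x. x \<in> verts S2 \<and> degree S2 x = 1}
          \<union> {{ApexZ, Base (Inl x)} | x. x \<in> verts S1 \<and> degree S1 x = 2} \<rparr>)"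

lemma finite_edges: "finite_simple_graph G \<Longrightarrow> finite (edges G)"
  unfolding finite_simple_graph_def
  by (rule finite_subset[of _ "Pow (verts G)"]) auto

lemma no_isolated_vertsI:
  assumes "finite_simple_graph G" "\<And>x. x \<in> verts G \<Longrightarrow> \<exists>e\<in>edges G. x \<in> e"
  shows "no_isolated_verts G"
  unfolding no_isolated_verts_def degree_def
proof
  fix x assume "x \<in> verts G"
  then have "{e \<in> edges G. x \<in> e} \<noteq> {}" using assms(2) by blast
  then show "card {e \<in> edges G. x \<in> e} \<noteq> 0"
    using finite_edges[OF assms(1)] by simp
qed

lemma no_isolated_vertsD:
  "no_isolated_verts G \<Longrightarrow> x \<in> verts G \<Longrightarrow> \<exists>e\<in>edges G. x \<in> e"
  unfolding no_isolated_verts_def degree_def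
  by (metis (mono_tags, lifting) Collect_empty_eq card.empty)

lemma finite_simple_graph_copies:
  assumes "finite_simple_graph G"
  shows "finite_simple_graph (copies r G)"
  using assms unfolding finite_simple_graph_def copies_def
  by (auto simp: card_image inj_on_def)

lemma no_isolated_verts_copies:
  assumes "finite_simple_graph G" "no_isolated_verts G"
  shows "no_isolated_verts (copies r G)"
proof (rule no_isolated_vertsI[OF finite_simple_graph_copies[OF assms(1)]])
  fix x assume "x \<in> verts (copies r G)"
  then obtain i v where x: "x = (i, v)" "i < r" "v \<in> verts G"
    by (auto simp: copies_def)
  with no_isolated_vertsD[OF assms(2)] obtain e where "e \<in> edges G" "v \<in> e" by blast
  then show "\<exists>e\<in>edges (copies r G). x \<in> e"
    using x by (auto simp: copies_def intro!: exI[of _ "Pair i ` e"])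
qed

lemma finite_simple_graph_path_graph: "finite_simple_graph (path_graph n)"
  unfolding finite_simple_graph_def path_graph_def by auto

lemma finite_simple_graph_disjoint_sum:
  assumes "finite_simple_graph G" "finite_simple_graph H"
  shows "finite_simple_graph (disjoint_sum G H)"
  using assms unfolding finite_simple_graph_def disjoint_sum_def
  by (auto simp: card_image inj_on_def)

lemma finite_simple_graph_diamond_fan: "finite_simple_graph (diamond_fan s)"
proof -
  define S where "S = copies s (path_graph 3)"
  define D where "D = disjoint_sum S S"
  have D: "finite_simple_graph D"
    unfolding D_def S_def by (intro finite_simple_graph_disjoint_sum finite_simple_graph_copies
        finite_simple_graph_path_graph)
  have verts: "verts (diamond_fan s) = Base ` verts D \<union> {ApexY, ApexZ}"
    by (simp add: diamond_fan_def Let_def D_def S_def)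
  have "e \<subseteq> verts (diamond_fan s) \<and> card e = 2" if "e \<in> edges (diamond_fan s)" for e
  proof -
    have "Inl v \<in> verts D" "Inr v \<in> verts D" if "v \<in> verts S" for v
      using that by (auto simp: D_def disjoint_sum_def)
    moreover have "e \<in> (`) Base ` edges D \<or>
      (\<exists>p\<in>{ApexY, ApexZ}. \<exists>v\<in>verts S. e = {p, Base (Inl v)} \<or> e = {p, Base (Inr v)})"
      using that unfolding diamond_fan_def Let_def S_def[symmetric] D_def[symmetric]
      by (simp only: graph.select_convs Un_iff mem_Collect_eq) blast
    ultimately consider e' where "e' \<in> edges D" "e = Base ` e'"
      | p x where "p \<in> {ApexY, ApexZ}" "x \<in> verts D" "e = {p, Base x}"
      by blast
    then show ?thesis
    proof cases
      case 1
      then have "e' \<subseteq> verts D" "card e' = 2"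
        using D by (auto simp: finite_simple_graph_def)
      then show ?thesis
        using 1 verts by (auto simp: card_image inj_on_def)
    next
      case 2
      then show ?thesis using verts by auto
    qed
  qed
  then show ?thesis
    using D verts by (simp add: finite_simple_graph_def)
qed

lemma path_graph_3: "path_graph 3 = \<lparr> verts = {0, 1, 2}, edges = {{0, 1}, {1, 2}} \<rparr>"
proof -
  have "{{i, Suc i} | i. Suc i < 3} = {{0::nat, 1}, {1, 2}}"
    by (auto simp: numeral_eq_Suc less_Suc_eq)
  moreover have "{..<3} = {0::nat, 1, 2}" by auto
  ultimately show ?thesis by (simp add: path_graph_def)
qed

lemma degree_copies_path_graph_3:
  assumes "i < s"
  shows "degree (copies s (path_graph 3)) (i, 0) = 1"
    and "degree (copies s (path_graph 3)) (i, 1) = 2"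
    and "degree (copies s (path_graph 3)) (i, 2) = 1"
proof -
  let ?E = "edges (copies s (path_graph 3))"
  have E: "?E = (\<Union>j<s. {{(j, 0), (j, 1)}, {(j, 1), (j, 2)}})"
  proof -
    have "?E = (\<Union>j<s. (`) (Pair j) ` edges (path_graph 3))"
      unfolding copies_def by auto
    then show ?thesis by (simp add: path_graph_3)
  qed
  have "{e \<in> ?E. (i, 0) \<in> e} = {{(i, 0), (i, 1)}}"
    "{e \<in> ?E. (i, 1) \<in> e} = {{(i, 0), (i, 1)}, {(i, 1), (i, 2)}}"
    "{e \<in> ?E. (i, 2) \<in> e} = {{(i, 1), (i, 2)}}"
    unfolding E using assms by auto
  then show "degree (copies s (path_graph 3)) (i, 0) = 1"
    and "degree (copies s (path_graph 3)) (i, 1) = 2"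
    and "degree (copies s (path_graph 3)) (i, 2) = 1"
    unfolding degree_def by (simp_all add: doubleton_eq_iff)
qed

lemma no_isolated_verts_diamond_fan:
  assumes "s \<ge> 1"
  shows "no_isolated_verts (diamond_fan s)"
proof (rule no_isolated_vertsI[OF finite_simple_graph_diamond_fan])
  let ?S = "copies s (path_graph 3)"
  have V: "x \<in> verts ?S \<longleftrightarrow> fst x < s \<and> snd x \<in> {0, 1, 2}" for x
    by (cases x) (auto simp: copies_def path_graph_3)
  have deg: "degree ?S x = 1 \<or> degree ?S x = 2" if "x \<in> verts ?S" for x
    using that degree_copies_path_graph_3[of "fst x" s] V[of x] by (cases x) auto
  have z: "(0, 0) \<in> verts ?S" "degree ?S (0, 0) = 1"
    using assms V[of "(0, 0)"] degree_copies_path_graph_3[of 0 s] by auto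
  have apex: "degree ?S v = 1 \<Longrightarrow> {ApexY, Base (Inl v)} \<in> edges (diamond_fan s)"
    "degree ?S v = 2 \<Longrightarrow> {ApexY, Base (Inr v)} \<in> edges (diamond_fan s)"
    "degree ?S v = 1 \<Longrightarrow> {ApexZ, Base (Inr v)} \<in> edges (diamond_fan s)"
    "degree ?S v = 2 \<Longrightarrow> {ApexZ, Base (Inl v)} \<in> edges (diamond_fan s)"
    if "v \<in> verts ?S" for v
    unfolding diamond_fan_def Let_def graph.select_convs Un_iff mem_Collect_eq
    using that by blast+
  fix x assume "x \<in> verts (diamond_fan s)"
  then consider v where "x = Base (Inl v)" "v \<in> verts ?S"
    | v where "x = Base (Inr v)" "v \<in> verts ?S" | "x = ApexY" | "x = ApexZ"
    by (auto simp: diamond_fan_def Let_def disjoint_sum_def)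
  then show "\<exists>e\<in>edges (diamond_fan s). x \<in> e"
  proof cases
    case 1
    then show ?thesis using deg[of v] apex(1,4)[of v] by blast
  next
    case 2
    then show ?thesis using deg[of v] apex(2,3)[of v] by blast
  next
    case 3
    then show ?thesis using z apex(1) by blast
  next
    case 4
    then show ?thesis using z apex(3) by blast
  qed
qed

end

theory Submission
  imports Defs
begin

text \<open>
  Lower bound: a component is bipartite, with both classes of size \<open>3s + 1\<close>. If only two values occur,
  the vertex sum is constant on each class; since every edge meets each class once, both classes have
  the same total, so the two values coincide.

  Upper bound: put \<open>t = rs\<close> and give the \<open>2t\<close> paths, over all copies, distinct positions
  \<open>m < 2t\<close>. The edges of the path at position \<open>m\<close>, say with leaves \<open>a\<close>, \<open>b\<close> and centre \<open>c\<close>,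
  get the labels \<open>2t + 1 + 2m\<close> for \<open>ac\<close>, \<open>2t - m\<close> for \<open>cb\<close>, and \<open>6t - 2m\<close>, \<open>6t + 1 + m\<close>,
  \<open>10t - m\<close> for the edges joining \<open>a\<close>, \<open>b\<close>, \<open>c\<close> to an apex. Leaves get the sum \<open>8t + 1\<close> and
  centres the sum \<open>14t + 1\<close>. The two paths with the same index in \<open>S\<^sub>1\<close> and \<open>S\<^sub>2\<close> take positions
  symmetric under \<open>m \<mapsto> 2t - 1 - m\<close>; together they contribute \<open>20t + 2\<close> to each apex.
\<close>

section \<open>Indexing the vertices and edges of one diamond fan\<close>

datatype link = LM | MR | AL | AM | AR

lemma UNIV_link: "UNIV = {LM, MR, AL, AM, AR}"
  using link.exhaust by auto

type_synonym fan_vertex = "((nat \<times> nat) + (nat \<times> nat)) with_apexes"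

text \<open>
  The Boolean selects the copy of \<open>sP\<^sub>3\<close>: false is \<open>S\<^sub>1\<close>, true is \<open>S\<^sub>2\<close>. Vertex \<open>1\<close> of a
  path is its centre. The apex indexed by \<open>b\<close> is the one joined to the leaves of the copy \<open>b\<close>.
\<close>

definition path_vertex :: "nat \<Rightarrow> bool \<Rightarrow> nat \<Rightarrow> fan_vertex" where
  "path_vertex i b k = Base (if b then Inr (i, k) else Inl (i, k))"

definition apex :: "bool \<Rightarrow> fan_vertex" where
  "apex b = (if b then ApexZ else ApexY)"

lemma path_vertex_eq_iff [simp]:
  "path_vertex i b k = path_vertex i' b' k' \<longleftrightarrow> i = i' \<and> b = b' \<and> k = k'"
  by (auto simp: path_vertex_def)

lemma apex_eq_iff [simp]: "apex b = apex b' \<longleftrightarrow> b = b'"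
  by (auto simp: apex_def)

lemma apex_neq_path_vertex [simp]:
  "apex b \<noteq> path_vertex i b' k" "path_vertex i b' k \<noteq> apex b"
  by (auto simp: apex_def path_vertex_def)

fun fan_edge :: "nat \<times> bool \<times> link \<Rightarrow> fan_vertex set" where
  "fan_edge (i, b, LM) = {path_vertex i b 0, path_vertex i b 1}"
| "fan_edge (i, b, MR) = {path_vertex i b 1, path_vertex i b 2}"
| "fan_edge (i, b, AL) = {apex b, path_vertex i b 0}"
| "fan_edge (i, b, AM) = {apex (\<not> b), path_vertex i b 1}"
| "fan_edge (i, b, AR) = {apex b, path_vertex i b 2}"

lemma inj_fan_edge: "inj fan_edge"
proof (rule injI)
  fix p q assume "fan_edge p = fan_edge q"
  moreover obtain i b k i' b' k' where "p = (i, b, k)" "q = (i', b', k')"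
    by (metis prod_cases3)
  ultimately show "p = q"
    by (cases k; cases k') (auto simp: doubleton_eq_iff)
qed

lemma verts_copies_path: "verts (copies s (path_graph 3)) = {..<s} \<times> {0, 1, 2}"
  by (simp add: copies_def path_graph_3)

lemma edges_copies_path:
  "edges (copies s (path_graph 3)) = (\<Union>i<s. {{(i, 0), (i, 1)}, {(i, 1), (i, 2)}})"
proof -
  have "edges (copies s (path_graph 3)) = (\<Union>i<s. (`) (Pair i) ` edges (path_graph 3))"
    unfolding copies_def by auto
  then show ?thesis by (simp add: path_graph_3)
qed

lemma leaf_copies_path:
  "{x \<in> verts (copies s (path_graph 3)). degree (copies s (path_graph 3)) x = 1} = {..<s} \<times> {0, 2}"
  and centre_copies_path:
  "{x \<in> verts (copies s (path_graph 3)). degree (copies s (path_graph 3)) x = 2} = {..<s} \<times> {1}"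
  using degree_copies_path_graph_3[of _ s] unfolding verts_copies_path by auto

lemma verts_diamond_fan:
  "verts (diamond_fan s) =
     range apex \<union> (\<lambda>(i, b, k). path_vertex i b k) ` ({..<s} \<times> UNIV \<times> {0, 1, 2})"
  unfolding diamond_fan_def Let_def disjoint_sum_def verts_copies_path graph.select_convs
    apex_def path_vertex_def image_def UNIV_bool
  by auto

text \<open>Splitting the edges by the copy \<open>b\<close> and the kind \<open>k\<close> gives ten
  families indexed by \<open>i\<close>, which together exhaust the comprehensions in the definition
  of the fan. Sums over incident edges thereby become sums over indices.\<close>

lemma edges_diamond_fan: "edges (diamond_fan s) = fan_edge ` ({..<s} \<times> UNIV)"
proof -
  let ?S = "copies s (path_graph 3)"
  have "edges (diamond_fan s) =
    (`) Base ` ((`) Inl ` edges ?S \<union> (`) Inr ` edges ?S)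
      \<union> (\<lambda>x. {ApexY, Base (Inl x)}) ` {x \<in> verts ?S. degree ?S x = 1}
      \<union> (\<lambda>x. {ApexY, Base (Inr x)}) ` {x \<in> verts ?S. degree ?S x = 2}
      \<union> (\<lambda>x. {ApexZ, Base (Inr x)}) ` {x \<in> verts ?S. degree ?S x = 1}
      \<union> (\<lambda>x. {ApexZ, Base (Inl x)}) ` {x \<in> verts ?S. degree ?S x = 2}"
    by (simp only: diamond_fan_def Let_def disjoint_sum_def graph.select_convs setcompr_eq_image)
  also have "\<dots> = (\<Union>b. \<Union>k. (\<lambda>i. fan_edge (i, b, k)) ` {..<s})"
  proof -
    have UN_doubleton: "(\<Union>i\<in>I. {g i, h i}) = g ` I \<union> h ` I" for g h :: "nat \<Rightarrow> 'c" and I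
      by auto
    have image_times: "g ` (I \<times> {k}) = (\<lambda>i. g (i, k)) ` I"
      "g ` (I \<times> {k, l}) = (\<lambda>i. g (i, k)) ` I \<union> (\<lambda>i. g (i, l)) ` I"
      for g :: "nat \<times> nat \<Rightarrow> 'c" and I k l
      by auto
    show ?thesis
      unfolding leaf_copies_path centre_copies_path edges_copies_path UN_doubleton image_times
        UNIV_bool UNIV_link
      by (simp add: image_Un image_image path_vertex_def apex_def Un_ac)
  qed
  also have "\<dots> = fan_edge ` ({..<s} \<times> UNIV)"
    by auto
  finally show ?thesis .
qed

section \<open>Edges and vertex sums of the disjoint union\<close>

definition fan_copy_edge :: "nat \<times> nat \<times> bool \<times> link \<Rightarrow> (nat \<times> fan_vertex) set" where
  "fan_copy_edge = (\<lambda>(j, p). Pair j ` fan_edge p)"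

abbreviation fan_copies_index :: "nat \<Rightarrow> nat \<Rightarrow> (nat \<times> nat \<times> bool \<times> link) set" where
  "fan_copies_index r s \<equiv> {..<r} \<times> {..<s} \<times> UNIV"

text \<open>Needed to recover the copy index: the image of an empty set under \<open>Pair j\<close>
  would forget \<open>j\<close>.\<close>

lemma fan_edge_nonempty: "fan_edge p \<noteq> {}"
  by (cases p rule: fan_edge.cases) auto

text \<open>First components of an edge determine its copy, second components its edge in the fan.
  Injectivity on the whole type lets sums be reindexed and makes \<open>inv fan_copy_edge\<close> a
  left inverse.\<close>

lemma inj_fan_copy_edge: "inj fan_copy_edge"
proof (rule injI)
  fix p q assume eq: "fan_copy_edge p = fan_copy_edge q"
  obtain j p' l q' where pq: "p = (j, p')" "q = (l, q')" by (cases p, cases q)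
  have im: "Pair j ` fan_edge p' = Pair l ` fan_edge q'"
    using eq by (simp add: fan_copy_edge_def pq)
  then have "fst ` Pair j ` fan_edge p' = fst ` Pair l ` fan_edge q'"
    and "snd ` Pair j ` fan_edge p' = snd ` Pair l ` fan_edge q'"
    by simp_all
  then show "p = q"
    using fan_edge_nonempty[of p'] fan_edge_nonempty[of q'] injD[OF inj_fan_edge]
    by (simp add: image_image pq image_constant_conv)
qed

lemma edges_fan_copies:
  "edges (copies r (diamond_fan s)) = fan_copy_edge ` fan_copies_index r s"
  unfolding copies_def edges_diamond_fan fan_copy_edge_def by auto

lemma vertex_sum_fan_copies:
  "vertex_sum (copies r (diamond_fan s)) f x =
     (\<Sum>p \<in> {p \<in> fan_copies_index r s. x \<in> fan_copy_edge p}. f (fan_copy_edge p))"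
proof -
  have "{e. e \<in> edges (copies r (diamond_fan s)) \<and> x \<in> e} =
      fan_copy_edge ` {p \<in> fan_copies_index r s. x \<in> fan_copy_edge p}"
    unfolding edges_fan_copies by auto
  then show ?thesis
    unfolding vertex_sum_def
    by (simp add: sum.reindex[OF inj_on_subset[OF inj_fan_copy_edge subset_UNIV]])
qed

lemma mem_fan_copy_edge:
  "(j, apex b) \<in> fan_copy_edge (l, i, c, k) \<longleftrightarrow>
     j = l \<and> (k = AL \<and> b = c \<or> k = AM \<and> b = (\<not> c) \<or> k = AR \<and> b = c)"
  "(j, path_vertex i' b 0) \<in> fan_copy_edge (l, i, c, k) \<longleftrightarrow>
     j = l \<and> i' = i \<and> b = c \<and> (k = LM \<or> k = AL)"
  "(j, path_vertex i' b 1) \<in> fan_copy_edge (l, i, c, k) \<longleftrightarrow>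
     j = l \<and> i' = i \<and> b = c \<and> (k = LM \<or> k = MR \<or> k = AM)"
  "(j, path_vertex i' b 2) \<in> fan_copy_edge (l, i, c, k) \<longleftrightarrow>
     j = l \<and> i' = i \<and> b = c \<and> (k = MR \<or> k = AR)"
  by (cases k; auto simp: fan_copy_edge_def)+

lemma vertex_sum_path_vertex:
  assumes "j < r" "i < s"
  shows "vertex_sum (copies r (diamond_fan s)) f (j, path_vertex i b 0) =
      f (fan_copy_edge (j, i, b, LM)) + f (fan_copy_edge (j, i, b, AL))"
    and "vertex_sum (copies r (diamond_fan s)) f (j, path_vertex i b 1) =
      f (fan_copy_edge (j, i, b, LM)) + f (fan_copy_edge (j, i, b, MR))
        + f (fan_copy_edge (j, i, b, AM))"
    and "vertex_sum (copies r (diamond_fan s)) f (j, path_vertex i b 2) =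
      f (fan_copy_edge (j, i, b, MR)) + f (fan_copy_edge (j, i, b, AR))"
proof -
  have "{p \<in> fan_copies_index r s. (j, path_vertex i b 0) \<in> fan_copy_edge p} =
      {(j, i, b, LM), (j, i, b, AL)}"
    "{p \<in> fan_copies_index r s. (j, path_vertex i b 1) \<in> fan_copy_edge p} =
      {(j, i, b, LM), (j, i, b, MR), (j, i, b, AM)}"
    "{p \<in> fan_copies_index r s. (j, path_vertex i b 2) \<in> fan_copy_edge p} =
      {(j, i, b, MR), (j, i, b, AR)}"
    using assms by (auto simp: mem_fan_copy_edge simp del: One_nat_def)
  then show "vertex_sum (copies r (diamond_fan s)) f (j, path_vertex i b 0) =
      f (fan_copy_edge (j, i, b, LM)) + f (fan_copy_edge (j, i, b, AL))"
    and "vertex_sum (copies r (diamond_fan s)) f (j, path_vertex i b 1) =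
      f (fan_copy_edge (j, i, b, LM)) + f (fan_copy_edge (j, i, b, MR))
        + f (fan_copy_edge (j, i, b, AM))"
    and "vertex_sum (copies r (diamond_fan s)) f (j, path_vertex i b 2) =
      f (fan_copy_edge (j, i, b, MR)) + f (fan_copy_edge (j, i, b, AR))"
    by (simp_all add: vertex_sum_fan_copies del: One_nat_def)
qed

lemma vertex_sum_apex:
  assumes "j < r"
  shows "vertex_sum (copies r (diamond_fan s)) f (j, apex b) =
    (\<Sum>i<s. f (fan_copy_edge (j, i, b, AL)) + f (fan_copy_edge (j, i, b, AR))
      + f (fan_copy_edge (j, i, \<not> b, AM)))"
proof -
  let ?g = "\<lambda>i. {(j, i, b, AL), (j, i, b, AR), (j, i, \<not> b, AM)}"
  have "{p \<in> fan_copies_index r s. (j, apex b) \<in> fan_copy_edge p} = (\<Union>i<s. ?g i)"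
    using assms by (auto simp: mem_fan_copy_edge)
  moreover have "(\<Sum>p\<in>(\<Union>i<s. ?g i). f (fan_copy_edge p)) =
      (\<Sum>i<s. \<Sum>p\<in>?g i. f (fan_copy_edge p))"
    by (rule sum.UNION_disjoint) auto
  ultimately show ?thesis
    by (simp add: vertex_sum_fan_copies add.assoc)
qed

section \<open>Lower bound: two values are impossible\<close>

lemma fan_copy_edge_in_edges:
  assumes "j < r" "i < s"
  shows "fan_copy_edge (j, i, b, k) \<in> edges (copies r (diamond_fan s))"
  using assms unfolding edges_fan_copies by blast

lemma card_vertex_sum_ge_3:
  assumes "r \<ge> 1" "s \<ge> 1" and f: "local_antimagic (copies r (diamond_fan s)) f"
  shows "card (vertex_sum (copies r (diamond_fan s)) f ` verts (copies r (diamond_fan s))) \<ge> 3"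
proof (rule ccontr)
  let ?G = "copies r (diamond_fan s)"
  \<comment> \<open>One component suffices; the argument stays in copy \<open>0\<close>.\<close>
  let ?h = "\<lambda>v. vertex_sum ?G f (0, v)"
  define p where "p = ?h (apex False)"
  define q where "q = ?h (path_vertex 0 False 0)"
  have 0: "0 < r" "0 < s" using assms by simp_all
  have adj: "?h u \<noteq> ?h v" if "fan_edge (i, b, k) = {u, v}" "i < s" for i b k u v
  proof -
    have "fan_copy_edge (0, i, b, k) = {(0, u), (0, v)}"
      using that(1) by (simp add: fan_copy_edge_def)
    then have "{(0, u), (0, v)} \<in> edges ?G"
      using fan_copy_edge_in_edges[OF 0(1) that(2), of b k] by simp
    then show ?thesis
      using f unfolding local_antimagic_def by blast
  qed
  have apex_vert: "(0, apex b) \<in> verts ?G" for b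
    using 0 by (simp add: copies_def verts_diamond_fan)
  have path_vert: "(0, path_vertex i b k) \<in> verts ?G" if "i < s" "k \<in> {0, 1, 2}" for i b k
  proof -
    have "(i, b, k) \<in> {..<s} \<times> UNIV \<times> {0, 1, 2}" using that by simp
    then have "path_vertex i b k \<in> verts (diamond_fan s)"
      unfolding verts_diamond_fan by (intro UnI2 image_eqI[of _ _ "(i, b, k)"]) simp_all
    then show ?thesis using 0 by (simp add: copies_def)
  qed
  have pq: "p \<noteq> q"
    unfolding p_def q_def by (rule adj[of 0 False AL]) (use 0 in simp_all)
  assume less: "\<not> card (vertex_sum ?G f ` verts ?G) \<ge> 3"
  have "{p, q} = vertex_sum ?G f ` verts ?G"
  proof (rule card_seteq)
    show "finite (vertex_sum ?G f ` verts ?G)"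
      using finite_simple_graph_copies[OF finite_simple_graph_diamond_fan, of r s]
      by (simp add: finite_simple_graph_def)
    show "{p, q} \<subseteq> vertex_sum ?G f ` verts ?G"
      using apex_vert path_vert[OF 0(2)] by (simp add: p_def q_def)
    show "card (vertex_sum ?G f ` verts ?G) \<le> card {p, q}"
      using less pq by simp
  qed
  then have "?h v = p \<or> ?h v = q" if "(0, v) \<in> verts ?G" for v
    using that by blast
  then have two: "?h (apex b) = p \<or> ?h (apex b) = q"
    "i < s \<Longrightarrow> k \<in> {0, 1, 2} \<Longrightarrow> ?h (path_vertex i b k) = p \<or> ?h (path_vertex i b k) = q"
    for i b k
    using apex_vert path_vert by blast+
  \<comment> \<open>With only \<open>p\<close> and \<open>q\<close> available, adjacent vertices
    take opposite values. Starting from \<open>apex False\<close> with value \<open>p\<close>, this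
    propagates to its neighbours, then to the \<open>False\<close> centres, to
    \<open>apex True\<close>, and finally to the \<open>True\<close> leaves.\<close>
  have leafF: "?h (path_vertex i False k) = q" if "i < s" "k \<in> {0, 2}" for i k
  proof -
    have "p \<noteq> ?h (path_vertex i False k)"
      using that adj[of i False AL "apex False"] adj[of i False AR "apex False"]
      by (auto simp: p_def)
    then show ?thesis using two(2)[OF that(1), of k False] that(2) by auto
  qed
  have centreT: "?h (path_vertex i True 1) = q" if "i < s" for i
    using adj[of i True AM "apex False" "path_vertex i True 1"] two(2)[OF that, of 1 True] that
    by (simp add: p_def)
  have centreF: "?h (path_vertex i False 1) = p" if "i < s" for i
    using adj[of i False LM "path_vertex i False 0" "path_vertex i False 1"]
      leafF[OF that, of 0] two(2)[OF that, of 1 False] that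
    by simp
  have z: "?h (apex True) = q"
    using adj[of 0 False AM "apex True" "path_vertex 0 False 1"] centreF[of 0] two(1)[of True] 0
    by simp
  have leafT: "?h (path_vertex i True k) = p" if "i < s" "k \<in> {0, 2}" for i k
  proof -
    have "q \<noteq> ?h (path_vertex i True k)"
      using that z adj[of i True AL "apex True"] adj[of i True AR "apex True"] by auto
    then show ?thesis using two(2)[OF that(1), of k True] that(2) by auto
  qed
  \<comment> \<open>The two sides are the totals over the two bipartition classes. For each
    \<open>i\<close>, both expand to the sum of the same ten labels.\<close>
  have "?h (apex False) + (\<Sum>i<s. ?h (path_vertex i False 1) + ?h (path_vertex i True 0)
        + ?h (path_vertex i True 2)) =
      ?h (apex True) + (\<Sum>i<s. ?h (path_vertex i True 1) + ?h (path_vertex i False 0)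
        + ?h (path_vertex i False 2))"
    unfolding vertex_sum_apex[OF 0(1)] sum.distrib[symmetric]
    by (rule sum.cong) (simp_all add: vertex_sum_path_vertex[OF 0(1)] del: One_nat_def)
  then have "p + (\<Sum>i<s. p + p + p) = q + (\<Sum>i<s. q + q + q)"
    using leafF centreT centreF leafT z by (simp add: p_def[symmetric] del: One_nat_def)
  then have "(3 * s + 1) * p = (3 * s + 1) * q"
    by (simp add: algebra_simps)
  then show False using pq unfolding mult_cancel1 by simp
qed

section \<open>The labeling and its bijectivity\<close>

fun link_label :: "nat \<Rightarrow> nat \<Rightarrow> link \<Rightarrow> nat" where
  "link_label t m MR = 2 * t - m"
| "link_label t m LM = 2 * t + 1 + 2 * m"
| "link_label t m AL = 6 * t - 2 * m"
| "link_label t m AR = 6 * t + 1 + m"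
| "link_label t m AM = 10 * t - m"

lemma link_label_bounds: "m < 2 * t \<Longrightarrow> link_label t m k \<in> {1..10 * t}"
  by (cases k) auto

text \<open>As \<open>m\<close> runs below \<open>2 * t\<close>, \<open>MR\<close>,
  \<open>AR\<close> and \<open>AM\<close> fill the blocks from 1 to 2t, from 6t + 1 to 8t and from
  8t + 1 to 10t. \<open>LM\<close> and \<open>AL\<close> share the block from 2t + 1 to 6t, as its
  odd and even members.\<close>

lemma link_label_inj:
  assumes "link_label t m k = link_label t m' k'" "m < 2 * t" "m' < 2 * t"
  shows "m = m' \<and> k = k'"
proof -
  \<comment> \<open>No bound on \<open>y\<close> is required: a truncated difference is 0, still
    even.\<close>
  have parity: "2 * t + 1 + 2 * x \<noteq> 6 * t - 2 * y" for x y
  proof -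
    have "odd (2 * t + 1 + 2 * x)" "even (6 * t - 2 * y)" by simp_all
    then show ?thesis by metis
  qed
  show ?thesis
    using assms parity[of m m'] parity[of m' m] by (cases k; cases k') auto
qed

text \<open>For \<open>n < t\<close>, copy \<open>False\<close> occupies the upper half of the
  positions and copy \<open>True\<close> the lower half; the two positions for one \<open>n\<close>
  add up to 2t - 1.\<close>

definition path_position :: "nat \<Rightarrow> nat \<Rightarrow> bool \<Rightarrow> nat" where
  "path_position t n b = (if b then t - 1 - n else t + n)"

text \<open>\<open>j * s + i\<close> numbers the pairs of paths consecutively across all copies,
  from 0 to rs - 1.\<close>

definition fan_label :: "nat \<Rightarrow> nat \<Rightarrow> nat \<times> nat \<times> bool \<times> link \<Rightarrow> nat" where
  "fan_label r s = (\<lambda>(j, i, b, k). link_label (r * s) (path_position (r * s) (j * s + i) b) k)"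

lemma block_less:
  assumes "j < r" "i < s"
  shows "j * s + i < r * (s::nat)"
proof -
  have "j * s + i < Suc j * s" using assms by simp
  also have "\<dots> \<le> r * s" using assms by (intro mult_right_mono) auto
  finally show ?thesis .
qed

lemma block_inj:
  assumes "j * s + i = j' * s + i'" "i < s" "i' < (s::nat)"
  shows "j = j' \<and> i = i'"
proof -
  have "(j * s + i) div s = j" "(j * s + i) mod s = i"
    "(j' * s + i') div s = j'" "(j' * s + i') mod s = i'"
    using assms(2,3) by simp_all
  then show ?thesis using assms(1) by metis
qed

lemma path_position_less: "n < t \<Longrightarrow> path_position t n b < 2 * t"
  by (auto simp: path_position_def)

lemma path_position_inj:
  "path_position t n b = path_position t n' b' \<Longrightarrow> n < t \<Longrightarrow> n' < t \<Longrightarrow> n = n' \<and> b = b'"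
  by (auto simp: path_position_def split: if_splits)

lemma inj_on_fan_label: "inj_on (fan_label r s) (fan_copies_index r s)"
proof (rule inj_onI)
  fix p q
  assume p: "p \<in> fan_copies_index r s" and q: "q \<in> fan_copies_index r s"
    and eq: "fan_label r s p = fan_label r s q"
  obtain j i b k j' i' b' k' where pq: "p = (j, i, b, k)" "q = (j', i', b', k')"
    by (metis prod_cases4)
  have b: "j * s + i < r * s" "j' * s + i' < r * s" "i < s" "i' < s"
    using p q pq block_less by auto
  have "path_position (r * s) (j * s + i) b = path_position (r * s) (j' * s + i') b' \<and> k = k'"
    using eq b by (intro link_label_inj) (auto simp: fan_label_def pq path_position_less)
  then have "j * s + i = j' * s + i' \<and> b = b'" "k = k'"
    using b path_position_inj by blast+
  then show "p = q" using block_inj b pq by blast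
qed

lemma card_fan_copies_index: "card (fan_copies_index r s) = 10 * (r * s)"
  by (simp add: card_cartesian_product UNIV_Times_UNIV[symmetric] UNIV_bool UNIV_link
      del: UNIV_Times_UNIV)

text \<open>Surjectivity comes from counting: the map is injective into a set of the same
  size.\<close>

lemma bij_betw_fan_label: "bij_betw (fan_label r s) (fan_copies_index r s) {1..10 * (r * s)}"
proof -
  have "fan_label r s ` fan_copies_index r s = {1..10 * (r * s)}"
  proof (rule card_subset_eq)
    show "fan_label r s ` fan_copies_index r s \<subseteq> {1..10 * (r * s)}"
      unfolding fan_label_def
      by (clarify, intro link_label_bounds path_position_less block_less) auto
    show "card (fan_label r s ` fan_copies_index r s) = card {1..10 * (r * s)}"
      by (simp add: card_image[OF inj_on_fan_label] card_fan_copies_index)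
  qed simp
  then show ?thesis using inj_on_fan_label by (simp add: bij_betw_def)
qed

section \<open>Upper bound: vertex sums of the labeling\<close>

lemma exists_local_antimagic:
  assumes "r \<ge> 1" "s \<ge> 1"
  obtains f where "local_antimagic (copies r (diamond_fan s)) f"
    "vertex_sum (copies r (diamond_fan s)) f ` verts (copies r (diamond_fan s)) \<subseteq>
      {8 * (r * s) + 1, 14 * (r * s) + 1, s * (20 * (r * s) + 2)}"
proof
  let ?G = "copies r (diamond_fan s)"
  define t where "t = r * s"
  define f where "f e = fan_label r s (inv fan_copy_edge e)" for e
  have f: "f (fan_copy_edge p) = fan_label r s p" for p
    by (simp add: f_def inj_fan_copy_edge)
  have sums: "vertex_sum ?G f (j, path_vertex i b 0) = 8 * t + 1"
    "vertex_sum ?G f (j, path_vertex i b 1) = 14 * t + 1"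
    "vertex_sum ?G f (j, path_vertex i b 2) = 8 * t + 1" if "j < r" "i < s" for i j b
    using path_position_less[OF block_less[OF that], of b]
    unfolding vertex_sum_path_vertex[OF that] f fan_label_def t_def[symmetric] by simp_all
  have apex: "vertex_sum ?G f (j, apex b) = s * (20 * t + 2)" if "j < r" for j b
  proof -
    have "vertex_sum ?G f (j, apex b) = (\<Sum>i<s. 20 * t + 2)"
      unfolding vertex_sum_apex[OF that]
    proof (rule sum.cong)
      fix i assume "i \<in> {..<s}"
      then have "j * s + i < t" using block_less that t_def by auto
      \<comment> \<open>If copy \<open>b\<close> has position m, the other copy has 2t - 1 - m. The
        two leaf labels give 12t + 1 - m and the centre label 8t + 1 + m, so m cancels.\<close>
      then show "f (fan_copy_edge (j, i, b, AL)) + f (fan_copy_edge (j, i, b, AR))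
          + f (fan_copy_edge (j, i, \<not> b, AM)) = 20 * t + 2"
        unfolding f fan_label_def t_def[symmetric] by (cases b) (auto simp: path_position_def)
    qed simp
    then show ?thesis by simp
  qed
  show "vertex_sum ?G f ` verts ?G \<subseteq> {8 * (r * s) + 1, 14 * (r * s) + 1, s * (20 * (r * s) + 2)}"
    using sums apex unfolding t_def[symmetric]
    by (auto simp: copies_def verts_diamond_fan simp del: One_nat_def)
  have neq: "8 * t + 1 \<noteq> 14 * t + 1" "8 * t + 1 \<noteq> s * (20 * t + 2)"
    "14 * t + 1 \<noteq> s * (20 * t + 2)"
  proof -
    have "t > 0" using assms by (simp add: t_def)
    \<comment> \<open>Naming the nonlinear product leaves linear inequalities: the apex value is at
      least 20t + 2, hence above both other values.\<close>
    moreover obtain d where "d = s * (20 * t + 2)" by simp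
    moreover from this have "20 * t + 2 \<le> d"
      using mult_le_mono1[OF assms(2), of "20 * t + 2"] by (simp only: mult_1)
    ultimately show "8 * t + 1 \<noteq> 14 * t + 1" "8 * t + 1 \<noteq> s * (20 * t + 2)"
      "14 * t + 1 \<noteq> s * (20 * t + 2)" by linarith+
  qed
  have edge_sums: "vertex_sum ?G f u \<noteq> vertex_sum ?G f v"
    if uv: "{u, v} \<in> edges ?G" for u v
  proof -
    obtain j i b k where ji: "j < r" "i < s" and e: "{u, v} = Pair j ` fan_edge (i, b, k)"
      using uv unfolding edges_fan_copies fan_copy_edge_def by auto
    \<comment> \<open>Vertices fall into leaves, centres and apexes, each with its own value, and no
      edge joins two vertices of the same type.\<close>
    show ?thesis
      using e sums[OF ji] apex[OF ji(1)] neq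
      by (cases k) (auto simp: doubleton_eq_iff simp del: One_nat_def)
  qed
  have card: "card (edges ?G) = 10 * (r * s)"
    unfolding edges_fan_copies
    by (simp add: card_image[OF inj_on_subset[OF inj_fan_copy_edge subset_UNIV]] card_fan_copies_index)
  have "bij_betw fan_copy_edge (fan_copies_index r s) (edges ?G)"
    unfolding edges_fan_copies
    by (intro bij_betw_imageI inj_on_subset[OF inj_fan_copy_edge subset_UNIV]) simp
  moreover have "bij_betw (f \<circ> fan_copy_edge) (fan_copies_index r s) {1..10 * (r * s)}"
    using bij_betw_fan_label by (simp add: comp_def f)
  ultimately have "bij_betw f (edges ?G) {1..card (edges ?G)}"
    unfolding card using bij_betw_comp_iff by blast
  then show "local_antimagic ?G f"
    using edge_sums by (auto simp: local_antimagic_def)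
qed

theorem theorem2p6:
  fixes r s :: nat
  assumes "r \<ge> 1" and "s \<ge> 1"
  shows "chi_la (copies r (diamond_fan s)) = 3"
proof (rule antisym)
  let ?G = "copies r (diamond_fan s)"
  show "3 \<le> chi_la ?G"
    unfolding chi_la_def
  proof (rule Inf_greatest)
    fix x assume "x \<in> {enat (card (vertex_sum ?G f ` verts ?G)) | f. local_antimagic ?G f}"
    then obtain f where "x = enat (card (vertex_sum ?G f ` verts ?G))" "local_antimagic ?G f"
      by blast
    then show "3 \<le> x"
      using card_vertex_sum_ge_3[OF assms] by (simp add: numeral_eq_enat)
  qed
  obtain f where f: "local_antimagic ?G f" and
    sub: "vertex_sum ?G f ` verts ?G \<subseteq> {8 * (r * s) + 1, 14 * (r * s) + 1, s * (20 * (r * s) + 2)}"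
    using exists_local_antimagic[OF assms] .
  have "chi_la ?G \<le> enat (card (vertex_sum ?G f ` verts ?G))"
    unfolding chi_la_def using f by (intro Inf_lower) blast
  also have "card (vertex_sum ?G f ` verts ?G) \<le> 3"
    using card_mono[OF _ sub] by (rule order.trans) (auto simp: card_insert_if)
  finally show "chi_la ?G \<le> 3" by (simp add: numeral_eq_enat)
qed

end
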